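(* Let $\mathcal M=(M,\mathcal U)$ be an orbifold and let $\mathcal T$ be a triangulation of $M$ adapted to $\mathcal U$. Then $|G_x|=\mathbf w(\mathrm{Car}_{\mathcal T}(x))$ for each point $x\in M$. Consequently, $(M,\lambda_{\mathcal M})$ is a weighted polyhedron of descending type.
   Context: Orbifolds: $M$ is a paracompact Hausdorff space and $\mathcal U$ an orbifold atlas (charts $\varphi:\tilde U\to M$ with a finite group $G$ acting smoothly and effectively on a connected open $\tilde U\subset\mathbb R^n$, $\varphi$ inducing a homeomorphism $\tilde U/G\cong\varphi(\tilde U)$ open in $M$, with the usual compatibility); one may take linear charts $(\mathbb R^n,G,\varphi)$ with $G\subset O(n,\mathbb R)$ finite. For $x\in M$, the local group $G_x$ is the isotropy group $\{g\in G: g\tilde x=\tilde x\}$ of a lift $\tilde x$ of $x$ in a linear chart, well defined up to conjugation in $O(n,\mathbb R)$; $\lambda_{\mathcal M}(x)=|G_x|$. Strata of $M$ are the connected components of $\{x\in M: (G_x)=(H)\}$, $(H)$ ranging over conjugacy classes of finite subgroups of $O(n,\mathbb R)$. A triangulation $\mathcal T$ of $M$ (also viewed as a simplicial complex) is adapted to $\mathcal U$ if the relative interior of each simplex is contained in a single stratum, the closure of every stratum is a subcomplex, the cover of $M$ by closed simplices refines the cover induced by $\mathcal U$ (so the isotropy groups of interior points of a simplex are the same and are subgroups of those of boundary points), and for every simplex $\sigma$ of $\mathcal T$ there is a proper (possibly empty) face $\tau$ of $\sigma$ such that the local group is constant on $\sigma\setminus\tau$, and possibly larger on $\tau$. Adapted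 triangulations always exist (Moerdijk–Pronk). For a simplex $\sigma$ of $\mathcal T$, $\mathbf w(\sigma)=\min\{|G_v|: v\text{ a vertex of }\sigma\}$. $\mathrm{Car}_{\mathcal T}(x)$ is the unique simplex of $\mathcal T$ containing $x$ in its relative interior. A descending weight on a simplicial complex $K$ is a function $\mu$ from simplices to positive integers with $\mu(\sigma)\mid\mu(\sigma')$ whenever $\sigma'$ is a face of $\sigma$; $\lambda_\mu:|K|\to\mathbb Z_+$ is $\lambda_\mu(x)=\mu(\mathrm{Car}_K(x))$. A pair $(X,\lambda)$ with $\lambda:X\to\mathbb Z_+$ is a weighted polyhedron of descending type if there are a simplicial complex $K$ with a descending weight $\mu$ and a homeomorphism $f:X\to|K|$ with $\lambda_\mu(f(x))=\lambda(x)$ for all $x$. *)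

theory Defs
  imports "HOL-Analysis.Analysis" "HOL-Algebra.Group_Action"
begin

section \<open>Smooth maps and smooth embeddings\<close>

text \<open>Only meant for open \<open>S\<close>: the derivatives are not taken within \<open>S\<close>.\<close>

primrec Ck_on :: "nat \<Rightarrow> 'a::real_normed_vector set \<Rightarrow> ('a \<Rightarrow> 'b::real_normed_vector) \<Rightarrow> bool" where
  "Ck_on 0 S f \<longleftrightarrow> continuous_on S f"
| "Ck_on (Suc k) S f \<longleftrightarrow>
     (\<forall>x\<in>S. f differentiable (at x)) \<and> (\<forall>v. Ck_on k S (\<lambda>x. frechet_derivative f (at x) v))"

definition smooth_on :: "'a::real_normed_vector set \<Rightarrow> ('a \<Rightarrow> 'b::real_normed_vector) \<Rightarrow> bool" where
  "smooth_on S f \<longleftrightarrow> (\<forall>k. Ck_on k S f)"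

definition smooth_embedding_on ::
    "'a::real_normed_vector set \<Rightarrow> ('a \<Rightarrow> 'b::real_normed_vector) \<Rightarrow> bool" where
  "smooth_embedding_on S f \<longleftrightarrow>
     smooth_on S f \<and> (\<forall>x\<in>S. inj (frechet_derivative f (at x))) \<and>
     (\<exists>g. homeomorphism S (f ` S) f g)"


section \<open>Orbifolds\<close>

definition paracompact_space :: "'m topology \<Rightarrow> bool" where
  "paracompact_space X \<longleftrightarrow>
     (\<forall>\<V>. (\<forall>V\<in>\<V>. openin X V) \<and> \<Union>\<V> = topspace X \<longrightarrow>
        (\<exists>\<W>. (\<forall>W\<in>\<W>. openin X W) \<and> \<Union>\<W> = topspace X \<and>
             (\<forall>W\<in>\<W>. \<exists>V\<in>\<V>. W \<subseteq> V) \<and> locally_finite_in X \<W>))"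

record ('n, 'm) chart =
  chart_dom :: "(real ^ 'n) set"
  chart_set :: "(real ^ 'n \<Rightarrow> real ^ 'n) set"
  chart_map :: "real ^ 'n \<Rightarrow> 'm"

text \<open>An effective action of a finite group on the domain is the same thing as a finite subgroup of
  the group of bijections of the domain. This is how the group \<open>G\<close> of a chart is encoded; the action
  is then given by evaluation, i.e. the action map is \<open>id\<close>.\<close>

definition chart_group :: "('n::finite, 'm) chart \<Rightarrow> (real ^ 'n \<Rightarrow> real ^ 'n) monoid" where
  "chart_group c = (BijGroup (chart_dom c))\<lparr>carrier := chart_set c\<rparr>"

definition chart_orbit :: "('n::finite, 'm) chart \<Rightarrow> real ^ 'n \<Rightarrow> (real ^ 'n) set" where
  "chart_orbit c = orbit (chart_group c) id"

definition orbit_space :: "('n::finite, 'm) chart \<Rightarrow> (real ^ 'n) set topology" where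
  "orbit_space c = topology (\<lambda>\<V>. \<V> \<subseteq> chart_orbit c ` chart_dom c \<and>
     openin (top_of_set (chart_dom c)) {x \<in> chart_dom c. chart_orbit c x \<in> \<V>})"

lemma openin_orbit_space:
  "openin (orbit_space c) \<V> \<longleftrightarrow> \<V> \<subseteq> chart_orbit c ` chart_dom c \<and>
     openin (top_of_set (chart_dom c)) {x \<in> chart_dom c. chart_orbit c x \<in> \<V>}"
proof -
  have "istopology (\<lambda>\<V>. \<V> \<subseteq> chart_orbit c ` chart_dom c \<and>
     openin (top_of_set (chart_dom c)) {x \<in> chart_dom c. chart_orbit c x \<in> \<V>})" (is "istopology ?P")
    unfolding istopology_def
  proof (intro conjI allI impI)
    fix S T assume "?P S" "?P T"
    moreover have "{x \<in> chart_dom c. chart_orbit c x \<in> S \<inter> T} =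
      {x \<in> chart_dom c. chart_orbit c x \<in> S} \<inter> {x \<in> chart_dom c. chart_orbit c x \<in> T}" by auto
    ultimately show "S \<inter> T \<subseteq> chart_orbit c ` chart_dom c"
      "openin (top_of_set (chart_dom c)) {x \<in> chart_dom c. chart_orbit c x \<in> S \<inter> T}"
      by (auto intro: openin_Int)
  next
    fix \<K> assume *: "\<forall>K\<in>\<K>. ?P K"
    have eq: "{x \<in> chart_dom c. chart_orbit c x \<in> \<Union>\<K>} =
      \<Union>((\<lambda>K. {x \<in> chart_dom c. chart_orbit c x \<in> K}) ` \<K>)" by auto
    show "\<Union>\<K> \<subseteq> chart_orbit c ` chart_dom c" using * by blast
    show "openin (top_of_set (chart_dom c)) {x \<in> chart_dom c. chart_orbit c x \<in> \<Union>\<K>}"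
      unfolding eq using * by (intro openin_Union) auto
  qed
  then show ?thesis by (simp add: orbit_space_def topology_inverse')
qed

definition orbifold_chart :: "'m topology \<Rightarrow> ('n::finite, 'm) chart \<Rightarrow> bool" where
  "orbifold_chart M c \<longleftrightarrow>
     open (chart_dom c) \<and> connected (chart_dom c) \<and>
     finite (chart_set c) \<and> subgroup (chart_set c) (BijGroup (chart_dom c)) \<and>
     (\<forall>g\<in>chart_set c. smooth_on (chart_dom c) g) \<and>
     openin M (chart_map c ` chart_dom c) \<and>
     (\<exists>q. homeomorphic_map (orbit_space c) (subtopology M (chart_map c ` chart_dom c)) q \<and>
          (\<forall>x\<in>chart_dom c. q (chart_orbit c x) = chart_map c x))"

definition chart_embedding ::
    "('n::finite, 'm) chart \<Rightarrow> ('n, 'm) chart \<Rightarrow> (real ^ 'n \<Rightarrow> real ^ 'n) \<Rightarrow> bool" where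
  "chart_embedding d c f \<longleftrightarrow>
     f ` chart_dom d \<subseteq> chart_dom c \<and> smooth_embedding_on (chart_dom d) f \<and>
     (\<forall>x\<in>chart_dom d. chart_map c (f x) = chart_map d x)"

text \<open>The chart \<open>e\<close> around the common point need not belong to the atlas.\<close>

definition compatible_charts ::
    "'m topology \<Rightarrow> ('n::finite, 'm) chart \<Rightarrow> ('n, 'm) chart \<Rightarrow> bool" where
  "compatible_charts M c d \<longleftrightarrow>
     (\<forall>x \<in> chart_map c ` chart_dom c \<inter> chart_map d ` chart_dom d.
        \<exists>e. orbifold_chart M e \<and> x \<in> chart_map e ` chart_dom e \<and>
            (\<exists>f. chart_embedding e c f) \<and> (\<exists>f. chart_embedding e d f))"

definition orbifold :: "'m topology \<Rightarrow> ('n::finite, 'm) chart set \<Rightarrow> bool" where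
  "orbifold M \<U> \<longleftrightarrow>
     paracompact_space M \<and> Hausdorff_space M \<and>
     (\<forall>c\<in>\<U>. orbifold_chart M c) \<and>
     (\<Union>c\<in>\<U>. chart_map c ` chart_dom c) = topspace M \<and>
     (\<forall>c\<in>\<U>. \<forall>d\<in>\<U>. compatible_charts M c d)"


section \<open>Local groups and strata\<close>

text \<open>Elements of \<open>O(n)\<close> are represented by the linear isometries of \<open>real ^ 'n\<close>.\<close>

definition orthogonal_group :: "(real ^ 'n \<Rightarrow> real ^ 'n::finite) monoid" where
  "orthogonal_group = \<lparr>carrier = {f. orthogonal_transformation f}, mult = (\<circ>), one = id\<rparr>"

definition linear_chart :: "'m topology \<Rightarrow> ('n::finite, 'm) chart \<Rightarrow> bool" where
  "linear_chart M c \<longleftrightarrow>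
     orbifold_chart M c \<and> chart_dom c = UNIV \<and> subgroup (chart_set c) orthogonal_group"

definition conjugate_in_O ::
    "(real ^ 'n \<Rightarrow> real ^ 'n::finite) set \<Rightarrow> (real ^ 'n \<Rightarrow> real ^ 'n) set \<Rightarrow> bool" where
  "conjugate_in_O H K \<longleftrightarrow>
     (\<exists>a. orthogonal_transformation a \<and> K = (\<lambda>h. a \<circ> h \<circ> inv_into UNIV a) ` H)"

definition O_conj_class ::
    "(real ^ 'n \<Rightarrow> real ^ 'n::finite) set \<Rightarrow> (real ^ 'n \<Rightarrow> real ^ 'n) set set" where
  "O_conj_class H = {K. conjugate_in_O H K}"

text \<open>The linear chart ranges over all linear charts of the maximal atlas containing \<open>\<U>\<close>, since
  the charts of \<open>\<U>\<close> itself need not be linear.\<close>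

definition is_local_group ::
    "'m topology \<Rightarrow> ('n::finite, 'm) chart set \<Rightarrow> 'm \<Rightarrow> (real ^ 'n \<Rightarrow> real ^ 'n) set \<Rightarrow> bool" where
  "is_local_group M \<U> x H \<longleftrightarrow>
     (\<exists>c. linear_chart M c \<and> (\<forall>d\<in>\<U>. compatible_charts M c d) \<and>
          (\<exists>y\<in>chart_dom c. chart_map c y = x \<and> H = stabilizer (chart_group c) id y))"

text \<open>A representative of \<open>G\<^sub>x\<close>, which is well defined only up to conjugation in \<open>O(n)\<close>.\<close>

definition local_group ::
    "'m topology \<Rightarrow> ('n::finite, 'm) chart set \<Rightarrow> 'm \<Rightarrow> (real ^ 'n \<Rightarrow> real ^ 'n) set" where
  "local_group M \<U> x = (SOME H. is_local_group M \<U> x H)"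

text \<open>The conjugacy class \<open>(G\<^sub>x)\<close>.\<close>

definition local_class ::
    "'m topology \<Rightarrow> ('n::finite, 'm) chart set \<Rightarrow> 'm \<Rightarrow> (real ^ 'n \<Rightarrow> real ^ 'n) set set" where
  "local_class M \<U> x = \<Union>{O_conj_class H |H. is_local_group M \<U> x H}"

definition local_order :: "'m topology \<Rightarrow> ('n::finite, 'm) chart set \<Rightarrow> 'm \<Rightarrow> nat" where
  "local_order M \<U> x = card (local_group M \<U> x)"

definition strata :: "'m topology \<Rightarrow> ('n::finite, 'm) chart set \<Rightarrow> 'm set set" where
  "strata M \<U> =
     (\<Union>H \<in> {H. finite H \<and> subgroup H orthogonal_group}.
        connected_components_of
          (subtopology M {x \<in> topspace M. local_class M \<U> x = O_conj_class H}))"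


section \<open>Simplicial complexes and their realizations\<close>

text \<open>The predicates \<open>simplicial_complex\<close> and \<open>triangulation\<close> of the library are restricted to
  finite complexes in a Euclidean space, so abstract complexes are used here. The empty face is not
  an element of a complex.\<close>

definition abstract_complex :: "'v set set \<Rightarrow> bool" where
  "abstract_complex K \<longleftrightarrow>
     (\<forall>\<sigma>\<in>K. finite \<sigma> \<and> \<sigma> \<noteq> {} \<and> (\<forall>\<tau>. \<tau> \<subseteq> \<sigma> \<and> \<tau> \<noteq> {} \<longrightarrow> \<tau> \<in> K))"

text \<open>Points of the realization are given by their barycentric coordinates. Note that
  \<open>closed_simplex {} = {}\<close>.\<close>

definition closed_simplex :: "'v set \<Rightarrow> ('v \<Rightarrow> real) set" where
  "closed_simplex \<sigma> = {t. (\<forall>v. 0 \<le> t v) \<and> (\<forall>v. v \<notin> \<sigma> \<longrightarrow> t v = 0) \<and> sum t \<sigma> = 1}"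

definition open_simplex :: "'v set \<Rightarrow> ('v \<Rightarrow> real) set" where
  "open_simplex \<sigma> = {t \<in> closed_simplex \<sigma>. \<forall>v\<in>\<sigma>. 0 < t v}"

definition vertex_point :: "'v \<Rightarrow> 'v \<Rightarrow> real" where
  "vertex_point v = (\<lambda>u. if u = v then 1 else 0)"

definition complex_points :: "'v set set \<Rightarrow> ('v \<Rightarrow> real) set" where
  "complex_points K = (\<Union>\<sigma>\<in>K. closed_simplex \<sigma>)"

text \<open>\<open>|K|\<close> with the weak topology determined by its closed simplices, where a closed simplex
  carries its Euclidean topology (as a subspace of a product of real lines).\<close>

definition realization :: "'v set set \<Rightarrow> ('v \<Rightarrow> real) topology" where
  "realization K = topology (\<lambda>W. W \<subseteq> complex_points K \<and>
     (\<forall>\<sigma>\<in>K. openin (top_of_set (closed_simplex \<sigma>)) (W \<inter> closed_simplex \<sigma>)))"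

lemma openin_realization:
  "openin (realization K) W \<longleftrightarrow> W \<subseteq> complex_points K \<and>
     (\<forall>\<sigma>\<in>K. openin (top_of_set (closed_simplex \<sigma>)) (W \<inter> closed_simplex \<sigma>))"
proof -
  have "istopology (\<lambda>W. W \<subseteq> complex_points K \<and>
     (\<forall>\<sigma>\<in>K. openin (top_of_set (closed_simplex \<sigma>)) (W \<inter> closed_simplex \<sigma>)))" (is "istopology ?P")
    unfolding istopology_def
  proof (intro conjI allI impI ballI)
    fix S T assume ST: "?P S" "?P T"
    then show "S \<inter> T \<subseteq> complex_points K" by blast
    fix \<sigma> assume "\<sigma> \<in> K"
    moreover have "S \<inter> T \<inter> closed_simplex \<sigma> = (S \<inter> closed_simplex \<sigma>) \<inter> (T \<inter> closed_simplex \<sigma>)" by blast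
    ultimately show "openin (top_of_set (closed_simplex \<sigma>)) (S \<inter> T \<inter> closed_simplex \<sigma>)"
      using ST by (simp add: openin_Int)
  next
    fix \<K> assume *: "\<forall>S\<in>\<K>. ?P S"
    then show "\<Union>\<K> \<subseteq> complex_points K" by blast
    fix \<sigma> assume "\<sigma> \<in> K"
    then show "openin (top_of_set (closed_simplex \<sigma>)) (\<Union>\<K> \<inter> closed_simplex \<sigma>)"
      unfolding Int_Union2 using * by (intro openin_Union) auto
  qed
  then show ?thesis by (simp add: realization_def topology_inverse')
qed

definition carrier_simplex :: "'v set set \<Rightarrow> ('v \<Rightarrow> real) \<Rightarrow> 'v set" where
  "carrier_simplex K t = (THE \<sigma>. \<sigma> \<in> K \<and> t \<in> open_simplex \<sigma>)"


section \<open>Weighted polyhedra of descending type\<close>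

definition descending_weight :: "'v set set \<Rightarrow> ('v set \<Rightarrow> nat) \<Rightarrow> bool" where
  "descending_weight K \<mu> \<longleftrightarrow>
     (\<forall>\<sigma>\<in>K. 0 < \<mu> \<sigma>) \<and> (\<forall>\<sigma>\<in>K. \<forall>\<sigma>'\<in>K. \<sigma>' \<subseteq> \<sigma> \<longrightarrow> \<mu> \<sigma> dvd \<mu> \<sigma>')"

definition weight_function :: "'v set set \<Rightarrow> ('v set \<Rightarrow> nat) \<Rightarrow> ('v \<Rightarrow> real) \<Rightarrow> nat" where
  "weight_function K \<mu> t = \<mu> (carrier_simplex K t)"

text \<open>The first argument names the type from which the vertices of the complex are taken.\<close>

definition weighted_polyhedron_descending ::
    "'v itself \<Rightarrow> 'm topology \<Rightarrow> ('m \<Rightarrow> nat) \<Rightarrow> bool" where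
  "weighted_polyhedron_descending (_ :: 'v itself) X l \<longleftrightarrow>
     (\<exists>(K :: 'v set set) \<mu> f.
        abstract_complex K \<and> descending_weight K \<mu> \<and>
        homeomorphic_map X (realization K) f \<and>
        (\<forall>x\<in>topspace X. weight_function K \<mu> (f x) = l x))"


section \<open>Adapted triangulations\<close>

text \<open>A triangulation is a complex \<open>K\<close> together with a homeomorphism \<open>h\<close> from \<open>|K|\<close> onto \<open>M\<close>; the
  simplices of \<open>M\<close> are the images under \<open>h\<close>.\<close>

definition triangulates :: "'v set set \<Rightarrow> (('v \<Rightarrow> real) \<Rightarrow> 'm) \<Rightarrow> 'm topology \<Rightarrow> bool" where
  "triangulates K h M \<longleftrightarrow> abstract_complex K \<and> homeomorphic_map (realization K) M h"

definition Car :: "'v set set \<Rightarrow> (('v \<Rightarrow> real) \<Rightarrow> 'm) \<Rightarrow> 'm \<Rightarrow> 'v set" where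
  "Car K h x = (THE \<sigma>. \<sigma> \<in> K \<and> x \<in> h ` open_simplex \<sigma>)"

definition vertex_weight ::
    "'m topology \<Rightarrow> ('n::finite, 'm) chart set \<Rightarrow> (('v \<Rightarrow> real) \<Rightarrow> 'm) \<Rightarrow> 'v set \<Rightarrow> nat" where
  "vertex_weight M \<U> h \<sigma> = Min ((\<lambda>v. local_order M \<U> (h (vertex_point v))) ` \<sigma>)"

text \<open>In the last clause, local groups are compared up to conjugation in \<open>O(n)\<close>: being constant
  refers to the class \<open>(G\<^sub>x)\<close>, and being possibly larger means containing a conjugate.\<close>

definition adapted_triangulation ::
    "'m topology \<Rightarrow> ('n::finite, 'm) chart set \<Rightarrow> 'v set set \<Rightarrow> (('v \<Rightarrow> real) \<Rightarrow> 'm) \<Rightarrow> bool" where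
  "adapted_triangulation M \<U> K h \<longleftrightarrow>
     triangulates K h M \<and>
     (\<forall>\<sigma>\<in>K. \<exists>S\<in>strata M \<U>. h ` open_simplex \<sigma> \<subseteq> S) \<and>
     (\<forall>S\<in>strata M \<U>. \<exists>L\<subseteq>K. abstract_complex L \<and> M closure_of S = h ` complex_points L) \<and>
     (\<forall>\<sigma>\<in>K. \<exists>c\<in>\<U>. h ` closed_simplex \<sigma> \<subseteq> chart_map c ` chart_dom c) \<and>
     (\<forall>\<sigma>\<in>K. \<exists>\<tau>. \<tau> \<subset> \<sigma> \<and>
        (\<forall>x \<in> h ` closed_simplex \<sigma> - h ` closed_simplex \<tau>.
         \<forall>y \<in> h ` closed_simplex \<sigma> - h ` closed_simplex \<tau>.
            local_class M \<U> x = local_class M \<U> y) \<and>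
        (\<forall>x \<in> h ` closed_simplex \<sigma> - h ` closed_simplex \<tau>. \<forall>y \<in> h ` closed_simplex \<tau>.
            \<exists>H\<in>local_class M \<U> x. \<exists>H'\<in>local_class M \<U> y. H \<subseteq> H'))"

end

theory Submission
  imports Defs
begin

text \<open>Every open simplex lies in a stratum, and on a stratum the class \<open>(G\<^sub>x)\<close> is a single conjugacy
  class of finite subgroups of \<open>O(n)\<close>; so local groups exist everywhere and \<open>|G\<^sub>x|\<close> is the order of
  any member of \<open>(G\<^sub>x)\<close>. In a simplex \<open>\<sigma>\<close>, the interior points and the vertices outside the
  exceptional face \<open>\<tau>\<close> have the same class, while by Lagrange's theorem the order at a point
  of \<open>\<tau>\<close> is a multiple of the order at an interior point. Hence the order at interior points is the
  minimum over the vertices, and it divides the orders on all of \<open>\<sigma>\<close>.\<close>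

section \<open>Finite subgroups of the orthogonal group\<close>

lemma group_orthogonal_group: "group (orthogonal_group :: (real ^ 'n \<Rightarrow> real ^ 'n::finite) monoid)"
proof (rule groupI)
  fix f assume f: "f \<in> carrier (orthogonal_group :: (real ^ 'n \<Rightarrow> real ^ 'n) monoid)"
  then have "orthogonal_transformation (inv_into UNIV f)" "inv_into UNIV f \<circ> f = id"
    by (auto simp: orthogonal_group_def orthogonal_transformation_inv orthogonal_transformation_inj)
  then show "\<exists>g\<in>carrier orthogonal_group. g \<otimes>\<^bsub>orthogonal_group\<^esub> f = \<one>\<^bsub>orthogonal_group\<^esub>"
    by (auto simp: orthogonal_group_def)
qed (auto simp: orthogonal_group_def orthogonal_transformation_compose o_assoc
      orthogonal_transformation_id id_def)

text \<open>Lagrange's theorem with \<open>H'\<close> in the role of the whole group, since the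
  ambient O(n) may be infinite.\<close>

lemma (in group) card_subgroup_dvd:
  assumes "subgroup H G" "subgroup H' G" "H \<subseteq> H'"
  shows "card H dvd card H'"
proof -
  interpret H': group "G\<lparr>carrier := H'\<rparr>" using assms(2) by (rule subgroup_imp_group)
  have "subgroup H (G\<lparr>carrier := H'\<rparr>)" using assms by (rule subgroup_incl)
  from H'.lagrange[OF this] show ?thesis by (simp add: order_def) (metis dvd_triv_right)
qed

lemma O_conj_class_refl:
  fixes H :: "(real ^ 'n \<Rightarrow> real ^ 'n::finite) set"
  shows "H \<in> O_conj_class H"
proof -
  have "H = (\<lambda>h. id \<circ> h \<circ> inv_into UNIV id) ` H" by simp
  moreover have "orthogonal_transformation (id :: real ^ 'n \<Rightarrow> real ^ 'n)"
    by (simp add: id_def)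
  ultimately show ?thesis unfolding O_conj_class_def conjugate_in_O_def by blast
qed

text \<open>Conjugation by \<open>a\<close> is injective, being undone by conjugation by the inverse
  of \<open>a\<close>. So the order of a local group depends only on its class.\<close>

lemma card_O_conj_class:
  fixes H :: "(real ^ 'n \<Rightarrow> real ^ 'n::finite) set"
  assumes "L \<in> O_conj_class H"
  shows "card L = card H"
proof -
  obtain a where a: "orthogonal_transformation a" and L: "L = (\<lambda>h. a \<circ> h \<circ> inv_into UNIV a) ` H"
    using assms by (auto simp: O_conj_class_def conjugate_in_O_def)
  have [simp]: "inv_into UNIV a (a x) = x" for x
    using a by (simp add: orthogonal_transformation_inj)
  have "inj_on (\<lambda>h. a \<circ> h \<circ> inv_into UNIV a) H"
  proof (rule inj_on_inverseI)
    fix h show "inv_into UNIV a \<circ> (a \<circ> h \<circ> inv_into UNIV a) \<circ> a = h" by (simp add: fun_eq_iff)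
  qed
  then show ?thesis unfolding L by (rule card_image)
qed

text \<open>Conjugation by \<open>a\<close> is an endomorphism of O(n). This makes Lagrange
  applicable to arbitrary members of a class, not only to the chosen representative.\<close>

lemma subgroup_O_conj_class:
  fixes H :: "(real ^ 'n \<Rightarrow> real ^ 'n::finite) set"
  assumes "L \<in> O_conj_class H" and "subgroup H orthogonal_group"
  shows "subgroup L orthogonal_group"
proof -
  obtain a where a: "orthogonal_transformation a" and L: "L = (\<lambda>h. a \<circ> h \<circ> inv_into UNIV a) ` H"
    using assms(1) by (auto simp: O_conj_class_def conjugate_in_O_def)
  have [simp]: "inv_into UNIV a (a x) = x" for x
    using a by (simp add: orthogonal_transformation_inj)
  interpret G: group "orthogonal_group :: (real ^ 'n \<Rightarrow> real ^ 'n) monoid"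
    by (rule group_orthogonal_group)
  have "(\<lambda>h. a \<circ> h \<circ> inv_into UNIV a) \<in> hom orthogonal_group orthogonal_group"
    using a by (auto simp: hom_def orthogonal_group_def fun_eq_iff
        intro!: orthogonal_transformation_compose orthogonal_transformation_inv)
  then interpret group_hom orthogonal_group orthogonal_group "\<lambda>h. a \<circ> h \<circ> inv_into UNIV a"
    by unfold_locales
  show ?thesis unfolding L using assms(2) by (rule subgroup_img_is_subgroup)
qed

section \<open>Points of the realization\<close>

lemma topspace_realization: "topspace (realization K) = complex_points K"
proof -
  have "openin (realization K) (complex_points K)"
    unfolding openin_realization complex_points_def by (auto simp: inf.absorb2 SUP_upper)
  then show ?thesis
    by (auto dest: openin_subset simp: topspace_def openin_realization)
qed

lemma open_simplex_subset_closed_simplex: "open_simplex \<sigma> \<subseteq> closed_simplex \<sigma>"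
  by (auto simp: open_simplex_def)

lemma closed_simplex_mono:
  assumes "\<tau> \<subseteq> \<sigma>" "finite \<sigma>"
  shows "closed_simplex \<tau> \<subseteq> closed_simplex \<sigma>"
proof
  fix t assume t: "t \<in> closed_simplex \<tau>"
  then have "sum t \<tau> = sum t \<sigma>"
    using assms by (intro sum.mono_neutral_left) (auto simp: closed_simplex_def)
  then show "t \<in> closed_simplex \<sigma>" using t assms by (auto simp: closed_simplex_def)
qed

text \<open>A point determines the simplex containing it in its relative interior: this gives the
  uniqueness behind \<open>carrier_simplex\<close> and \<open>Car\<close>.\<close>

lemma open_simplex_eq_support: "t \<in> open_simplex \<sigma> \<Longrightarrow> \<sigma> = {v. 0 < t v}"
  unfolding open_simplex_def closed_simplex_def by force

text \<open>At a vertex of \<sigma> outside \<tau>, the coordinate of \<open>t\<close> is positive,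
  while it vanishes on all of \<open>closed_simplex \<tau>\<close>.\<close>

lemma open_simplex_not_in_face:
  "t \<in> open_simplex \<sigma> \<Longrightarrow> \<tau> \<subset> \<sigma> \<Longrightarrow> t \<notin> closed_simplex \<tau>"
  by (auto simp: open_simplex_def closed_simplex_def) (metis less_irrefl)

lemma open_simplex_nonempty:
  assumes "finite \<sigma>" "\<sigma> \<noteq> {}"
  shows "open_simplex \<sigma> \<noteq> {}"
proof -
  \<comment> \<open>The witness is the barycentre.\<close>
  have "(\<lambda>v. if v \<in> \<sigma> then 1 / real (card \<sigma>) else 0) \<in> open_simplex \<sigma>"
    using assms by (auto simp: open_simplex_def closed_simplex_def card_gt_0_iff)
  then show ?thesis by blast
qed

lemma vertex_point_in_closed_simplex_iff:
  "finite \<sigma> \<Longrightarrow> vertex_point v \<in> closed_simplex \<sigma> \<longleftrightarrow> v \<in> \<sigma>"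
  by (auto simp: vertex_point_def closed_simplex_def)

text \<open>Existence of carriers: the support of \<open>t\<close> is a face of any simplex
  containing \<open>t\<close>, nonempty because the coordinates sum to 1.\<close>

lemma complex_points_in_open_simplex:
  assumes "abstract_complex K" "t \<in> complex_points K"
  obtains \<sigma> where "\<sigma> \<in> K" "t \<in> open_simplex \<sigma>"
proof -
  obtain \<rho> where \<rho>: "\<rho> \<in> K" "t \<in> closed_simplex \<rho>"
    using assms(2) by (auto simp: complex_points_def)
  define \<sigma> where "\<sigma> = {v \<in> \<rho>. 0 < t v}"
  have fin: "finite \<rho>" using \<rho> assms(1) by (auto simp: abstract_complex_def)
  have "sum t \<sigma> = sum t \<rho>"
    using \<rho>(2) fin unfolding \<sigma>_def
    by (intro sum.mono_neutral_left) (auto simp: closed_simplex_def order.order_iff_strict)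
  then have sum: "sum t \<sigma> = 1" using \<rho>(2) by (simp add: closed_simplex_def)
  then have "\<sigma> \<noteq> {}" by auto
  moreover have "\<sigma> \<subseteq> \<rho>" by (auto simp: \<sigma>_def)
  ultimately have "\<sigma> \<in> K" using \<rho>(1) assms(1) unfolding abstract_complex_def by blast
  moreover have nonneg: "0 \<le> t v" and zero: "v \<notin> \<rho> \<Longrightarrow> t v = 0" for v
    using \<rho>(2) by (auto simp: closed_simplex_def)
  have "t v = 0" if "v \<notin> \<sigma>" for v
    using nonneg[of v] zero[of v] that by (force simp: \<sigma>_def)
  then have "t \<in> open_simplex \<sigma>"
    using nonneg sum by (auto simp: open_simplex_def closed_simplex_def) (simp add: \<sigma>_def)
  ultimately show thesis by (rule that)
qed

lemma carrier_simplex_eq: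
  "\<sigma> \<in> K \<Longrightarrow> t \<in> open_simplex \<sigma> \<Longrightarrow> carrier_simplex K t = \<sigma>"
  unfolding carrier_simplex_def by (rule the_equality) (auto dest: open_simplex_eq_support)

lemma Car_eq:
  assumes inj: "inj_on h (complex_points K)" and \<sigma>: "\<sigma> \<in> K" "t \<in> open_simplex \<sigma>"
  shows "Car K h (h t) = \<sigma>"
  unfolding Car_def
proof (rule the_equality)
  fix \<rho> assume "\<rho> \<in> K \<and> h t \<in> h ` open_simplex \<rho>"
  then obtain s where s: "\<rho> \<in> K" "s \<in> open_simplex \<rho>" "h t = h s" by auto
  have "s \<in> complex_points K" "t \<in> complex_points K"
    using s \<sigma> open_simplex_subset_closed_simplex by (fastforce simp: complex_points_def)+
  then have "t = s" using inj s(3) by (auto dest: inj_onD)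
  then show "\<rho> = \<sigma>" using s(2) \<sigma>(2) by (metis open_simplex_eq_support)
qed (use \<sigma> in auto)

section \<open>Local orders in a simplex\<close>

text \<open>A stratum is contained in one of the subspaces whose components form
  \<open>strata\<close>; \<open>H\<close> is the group defining that subspace.\<close>

lemma stratum_local_class:
  assumes "S \<in> strata M \<U>" "x \<in> S"
  obtains H where "finite H" "subgroup H orthogonal_group" "local_class M \<U> x = O_conj_class H"
  using assms connected_components_of_subset[of S] by (fastforce simp: strata_def)

text \<open>\<open>local_class\<close> is the union of the classes of all local groups at
  \<open>x\<close>. On a stratum this union is a single class, so the group picked by
  \<open>SOME\<close> has the same order as any other member.\<close>

lemma local_order_eq_card:
  assumes S: "S \<in> strata M \<U>" "x \<in> S" and L: "L \<in> local_class M \<U> x"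
  shows "local_order M \<U> x = card L"
proof -
  obtain H where H: "local_class M \<U> x = O_conj_class H"
    using S by (rule stratum_local_class)
  \<comment> \<open>A nonempty \<open>local_class\<close> means that some local group exists, so the
    choice in \<open>local_group\<close> is meaningful.\<close>
  obtain L' where "is_local_group M \<U> x L'"
    using L by (auto simp: local_class_def)
  then have "is_local_group M \<U> x (local_group M \<U> x)"
    unfolding local_group_def by (rule someI)
  then have "local_group M \<U> x \<in> O_conj_class H"
    unfolding H[symmetric] local_class_def using O_conj_class_refl by blast
  then show ?thesis
    using L by (simp add: H local_order_def card_O_conj_class)
qed

lemma subgroup_of_local_class:
  assumes S: "S \<in> strata M \<U>" "x \<in> S" and L: "L \<in> local_class M \<U> x"
  shows "subgroup L orthogonal_group"
  using stratum_local_class[OF S] L subgroup_O_conj_class by metis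

lemma local_order_pos:
  assumes S: "S \<in> strata M \<U>" "x \<in> S"
  shows "0 < local_order M \<U> x"
proof -
  obtain H where H: "finite H" "subgroup H orthogonal_group" "local_class M \<U> x = O_conj_class H"
    using S by (rule stratum_local_class)
  then have "local_order M \<U> x = card H"
    using local_order_eq_card[OF S] O_conj_class_refl by blast
  then show ?thesis using H(1,2) by (metis card_gt_0_iff empty_iff subgroup.one_closed)
qed

lemma local_order_eqI:
  assumes S: "S \<in> strata M \<U>" "x \<in> S" and T: "T \<in> strata M \<U>" "y \<in> T"
    and eq: "local_class M \<U> x = local_class M \<U> y"
  shows "local_order M \<U> x = local_order M \<U> y"
proof -
  obtain H where "local_class M \<U> x = O_conj_class H"
    using S by (rule stratum_local_class)
  then have "H \<in> local_class M \<U> x" by (simp add: O_conj_class_refl)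
  then show ?thesis using local_order_eq_card[OF S] local_order_eq_card[OF T] eq by metis
qed

lemma local_order_dvdI:
  assumes S: "S \<in> strata M \<U>" "x \<in> S" and T: "T \<in> strata M \<U>" "y \<in> T"
    and H: "H \<in> local_class M \<U> x" "H' \<in> local_class M \<U> y" "H \<subseteq> H'"
  shows "local_order M \<U> x dvd local_order M \<U> y"
  using group.card_subgroup_dvd[OF group_orthogonal_group] H
    subgroup_of_local_class[OF S H(1)] subgroup_of_local_class[OF T H(2)]
    local_order_eq_card[OF S H(1)] local_order_eq_card[OF T H(2)] by metis

lemma adapted_triangulation_inj_on:
  "adapted_triangulation M \<U> K h \<Longrightarrow> inj_on h (complex_points K)"
  by (auto simp: adapted_triangulation_def triangulates_def topspace_realization[symmetric]
      dest: homeomorphic_imp_injective_map)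

text \<open>Supplies the stratum hypotheses of the preceding lemmas at every point of the complex,
  boundary points of simplices included, by passing to the carrier.\<close>

lemma adapted_triangulation_in_stratum:
  assumes "adapted_triangulation M \<U> K h" "t \<in> complex_points K"
  obtains S where "S \<in> strata M \<U>" "h t \<in> S"
proof -
  have "abstract_complex K"
    using assms(1) by (simp add: adapted_triangulation_def triangulates_def)
  then obtain \<sigma> where "\<sigma> \<in> K" "t \<in> open_simplex \<sigma>"
    using assms(2) by (rule complex_points_in_open_simplex)
  moreover have "\<exists>S\<in>strata M \<U>. h ` open_simplex \<sigma> \<subseteq> S"
    using assms(1) \<open>\<sigma> \<in> K\<close> unfolding adapted_triangulation_def by blast
  ultimately show thesis using that by blast
qed

text \<open>An interior point is compared with any other point of \<sigma>: off the exceptional face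
  \<tau> the classes agree, and on \<tau> a member of the interior class sits inside a member of the
  other.\<close>

lemma adapted_triangulation_local_order:
  assumes ad: "adapted_triangulation M \<U> K h" and \<sigma>: "\<sigma> \<in> K" and t: "t \<in> open_simplex \<sigma>"
  shows "s \<in> closed_simplex \<sigma> \<Longrightarrow> local_order M \<U> (h t) dvd local_order M \<U> (h s)"
    and "\<exists>v\<in>\<sigma>. local_order M \<U> (h (vertex_point v)) = local_order M \<U> (h t)"
proof -
  have fin: "finite \<sigma>"
    using ad \<sigma> by (auto simp: adapted_triangulation_def triangulates_def abstract_complex_def)
  have cp: "closed_simplex \<sigma> \<subseteq> complex_points K" using \<sigma> by (auto simp: complex_points_def)
  have tc: "t \<in> closed_simplex \<sigma>" using t open_simplex_subset_closed_simplex by blast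
  obtain \<tau> where \<tau>: "\<tau> \<subset> \<sigma>"
    and const: "\<And>x y. x \<in> h ` closed_simplex \<sigma> - h ` closed_simplex \<tau> \<Longrightarrow>
       y \<in> h ` closed_simplex \<sigma> - h ` closed_simplex \<tau> \<Longrightarrow> local_class M \<U> x = local_class M \<U> y"
    and larger: "\<And>x y. x \<in> h ` closed_simplex \<sigma> - h ` closed_simplex \<tau> \<Longrightarrow>
       y \<in> h ` closed_simplex \<tau> \<Longrightarrow> \<exists>H\<in>local_class M \<U> x. \<exists>H'\<in>local_class M \<U> y. H \<subseteq> H'"
    using ad \<sigma> unfolding adapted_triangulation_def by meson
  have \<tau>\<sigma>: "closed_simplex \<tau> \<subseteq> closed_simplex \<sigma>"
    using \<tau> fin by (intro closed_simplex_mono) auto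
  \<comment> \<open>Adaptedness speaks of images in \<open>M\<close>; injectivity of
    \<open>h\<close> turns membership there into membership in the realization.\<close>
  have h_iff: "h s \<in> h ` closed_simplex \<tau> \<longleftrightarrow> s \<in> closed_simplex \<tau>" if "s \<in> closed_simplex \<sigma>" for s
    using inj_on_image_mem_iff[OF adapted_triangulation_inj_on[OF ad]] that cp \<tau>\<sigma> by blast
  obtain S where S: "S \<in> strata M \<U>" "h t \<in> S"
    using adapted_triangulation_in_stratum[OF ad] tc cp by blast
  have t_out: "h t \<in> h ` closed_simplex \<sigma> - h ` closed_simplex \<tau>"
    using h_iff[OF tc] open_simplex_not_in_face[OF t \<tau>] tc by blast
  have eq: "local_order M \<U> (h t) = local_order M \<U> (h s)"
    if s: "s \<in> closed_simplex \<sigma>" "s \<notin> closed_simplex \<tau>" for s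
  proof -
    obtain T where T: "T \<in> strata M \<U>" "h s \<in> T"
      using adapted_triangulation_in_stratum[OF ad] s cp by blast
    have "h s \<in> h ` closed_simplex \<sigma> - h ` closed_simplex \<tau>" using h_iff s by blast
    then show ?thesis by (intro local_order_eqI[OF S T] const t_out)
  qed
  show "local_order M \<U> (h t) dvd local_order M \<U> (h s)" if s: "s \<in> closed_simplex \<sigma>"
  proof (cases "s \<in> closed_simplex \<tau>")
    case True
    obtain T where T: "T \<in> strata M \<U>" "h s \<in> T"
      using adapted_triangulation_in_stratum[OF ad] s cp by blast
    show ?thesis using larger[OF t_out, of "h s"] True local_order_dvdI[OF S T] by blast
  qed (simp add: eq[OF s])
  \<comment> \<open>Since \<tau> is a proper face, possibly empty, some vertex lies off it and
    carries the interior order.\<close>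
  obtain v where v: "v \<in> \<sigma>" "v \<notin> \<tau>" using \<tau> by blast
  have "finite \<tau>" using fin \<tau> by (meson finite_subset psubset_imp_subset)
  then show "\<exists>v\<in>\<sigma>. local_order M \<U> (h (vertex_point v)) = local_order M \<U> (h t)"
    using v eq[of "vertex_point v"] fin by (auto simp: vertex_point_in_closed_simplex_iff)
qed

text \<open>The interior order is attained at some vertex and divides the order at each vertex,
  hence is the minimum.\<close>

lemma vertex_weight_eq_local_order:
  assumes ad: "adapted_triangulation M \<U> K h" and \<sigma>: "\<sigma> \<in> K" and t: "t \<in> open_simplex \<sigma>"
  shows "vertex_weight M \<U> h \<sigma> = local_order M \<U> (h t)"
  unfolding vertex_weight_def
proof (rule Min_eqI)
  show "finite ((\<lambda>v. local_order M \<U> (h (vertex_point v))) ` \<sigma>)"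
    using ad \<sigma> by (auto simp: adapted_triangulation_def triangulates_def abstract_complex_def)
  show "local_order M \<U> (h t) \<in> (\<lambda>v. local_order M \<U> (h (vertex_point v))) ` \<sigma>"
    using adapted_triangulation_local_order(2)[OF assms] by (metis imageI)
  fix k assume "k \<in> (\<lambda>v. local_order M \<U> (h (vertex_point v))) ` \<sigma>"
  then obtain v where v: "v \<in> \<sigma>" "k = local_order M \<U> (h (vertex_point v))" by blast
  have vc: "vertex_point v \<in> closed_simplex \<sigma>"
    using ad \<sigma> v(1) by (auto simp: adapted_triangulation_def triangulates_def abstract_complex_def
        vertex_point_in_closed_simplex_iff)
  then obtain S where "S \<in> strata M \<U>" "h (vertex_point v) \<in> S"
    using adapted_triangulation_in_stratum[OF ad] \<sigma> by (auto simp: complex_points_def)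
  \<comment> \<open>Positivity is what turns divisibility into an inequality, since every number
    divides 0.\<close>
  then have "0 < k" unfolding v(2) by (rule local_order_pos)
  then show "local_order M \<U> (h t) \<le> k"
    using adapted_triangulation_local_order(1)[OF assms vc] v(2) by (simp add: dvd_imp_le)
qed

text \<open>The weight of a simplex is read off at an interior point, and an interior point of a
  face lies in the closed larger simplex, where divisibility is known.\<close>

lemma descending_weight_vertex_weight:
  assumes ad: "adapted_triangulation M \<U> K h"
  shows "descending_weight K (vertex_weight M \<U> h)"
proof -
  have simplex: "\<exists>t. t \<in> open_simplex \<sigma> \<and> t \<in> complex_points K \<and> finite \<sigma>" if "\<sigma> \<in> K" for \<sigma>
  proof -
    have fin: "finite \<sigma>" "\<sigma> \<noteq> {}"
      using ad that by (auto simp: adapted_triangulation_def triangulates_def abstract_complex_def)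
    moreover have "open_simplex \<sigma> \<subseteq> complex_points K"
      using that open_simplex_subset_closed_simplex by (force simp: complex_points_def)
    ultimately show ?thesis using open_simplex_nonempty by blast
  qed
  have "0 < vertex_weight M \<U> h \<sigma>" if \<sigma>: "\<sigma> \<in> K" for \<sigma>
    using simplex[OF \<sigma>] vertex_weight_eq_local_order[OF ad \<sigma>] local_order_pos
      adapted_triangulation_in_stratum[OF ad] by metis
  moreover have "vertex_weight M \<U> h \<sigma> dvd vertex_weight M \<U> h \<sigma>'"
    if \<sigma>: "\<sigma> \<in> K" "\<sigma>' \<in> K" "\<sigma>' \<subseteq> \<sigma>" for \<sigma> \<sigma>'
  proof -
    obtain t s where t: "t \<in> open_simplex \<sigma>" "finite \<sigma>" and s: "s \<in> open_simplex \<sigma>'"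
      using simplex \<sigma> by meson
    have "s \<in> closed_simplex \<sigma>"
      using s \<sigma>(3) t(2) open_simplex_subset_closed_simplex closed_simplex_mono by blast
    then show ?thesis
      using adapted_triangulation_local_order(1)[OF ad \<sigma>(1) t(1)]
        vertex_weight_eq_local_order[OF ad \<sigma>(1) t(1)] vertex_weight_eq_local_order[OF ad \<sigma>(2) s]
      by simp
  qed
  ultimately show ?thesis unfolding descending_weight_def by blast
qed

theorem proposition6p3:
  fixes M :: "'m topology"
    and \<U> :: "('n::finite, 'm) chart set"
    and K :: "'v set set"
    and h :: "('v \<Rightarrow> real) \<Rightarrow> 'm"
  assumes "orbifold M \<U>"
    and "adapted_triangulation M \<U> K h"
  shows "(\<forall>x\<in>topspace M. local_order M \<U> x = vertex_weight M \<U> h (Car K h x)) \<and>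
         weighted_polyhedron_descending TYPE('v) M (local_order M \<U>)"
proof -
  note ad = assms(2)
  have K: "abstract_complex K" and hom: "homeomorphic_map (realization K) M h"
    using ad by (auto simp: adapted_triangulation_def triangulates_def)
  \<comment> \<open>A weighted polyhedron asks for a map from \<open>M\<close> to the realization,
    so the inverse \<open>f\<close> of \<open>h\<close> serves, with \<open>K\<close> and the vertex
    weight.\<close>
  obtain f where f: "homeomorphic_maps (realization K) M h f"
    using hom by (auto simp: homeomorphic_map_maps)
  \<comment> \<open>The same \<sigma> is the value of both \<open>Car K h x\<close> and
    \<open>carrier_simplex K (f x)\<close>, which yields the formula and the weight condition
    together.\<close>
  have point: "\<exists>\<sigma> t. \<sigma> \<in> K \<and> t \<in> open_simplex \<sigma> \<and> h t = x \<and> f x = t" if x: "x \<in> topspace M" for x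
  proof -
    have "f x \<in> complex_points K" "h (f x) = x"
      using f x by (auto simp: homeomorphic_maps_def topspace_realization[symmetric]
          continuous_map_def)
    then show ?thesis using complex_points_in_open_simplex[OF K] by metis
  qed
  have "local_order M \<U> x = vertex_weight M \<U> h (Car K h x)" if "x \<in> topspace M" for x
    using point[OF that] Car_eq[OF adapted_triangulation_inj_on[OF ad]]
      vertex_weight_eq_local_order[OF ad] by metis
  moreover have "weight_function K (vertex_weight M \<U> h) (f x) = local_order M \<U> x"
    if "x \<in> topspace M" for x
    using point[OF that] carrier_simplex_eq[of _ K] vertex_weight_eq_local_order[OF ad]
    unfolding weight_function_def by metis
  moreover have "homeomorphic_map M (realization K) f"
    using f by (metis homeomorphic_maps_map)
  ultimately show ?thesis
    unfolding weighted_polyhedron_descending_def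
    using K descending_weight_vertex_weight[OF ad] by blast
qed

end
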